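(* Let $1 < \alpha < 2$, $1/\alpha + 1/\alpha' = 1$ and $p \geq \alpha'$. Then for every analytic function $F$ on $\mathbb D$ with $F(0) = 0$ we have $$\| F \|_{\mathcal B}^p \asymp \inf_{\omega \in S_3} \sup_{a \in \mathbb D} \left( \int_{\mathbb D} \int_{\mathbb D} \omega^\alpha (z, w) |F'(z)|^\alpha\, d \mu_a (z, w) \right)^{1/\alpha},$$ where $S_3 = S_3(F)$ is the set of measurable functions $\omega$ on $\mathbb D \times \mathbb D$ given by $$S_3 = \left\{ \omega \geq 0 : \sup_{a \in \mathbb D} \int_{\mathbb D} \int_{\mathbb D} |F'(z)|^{\alpha'(p-1)} \omega^{-\alpha'}(z, w) (1-|z|)^{p\alpha'}\, d \mu_a(z,w) \leq 1 \right\}.$$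
   Context: $\mathbb D = \{z \in \mathbb C : |z|<1\}$ is the unit disc and $dm$ is area measure on $\mathbb D$. For $F$ analytic on $\mathbb D$, the Bloch seminorm is $\|F\|_{\mathcal B} = \sup_{z\in\mathbb D} |F'(z)|(1-|z|) \in [0,\infty]$. For $a \in \mathbb D$, $\mu_a$ is the measure on $\mathbb D\times\mathbb D$ defined by $$d\mu_a(z,w) = \frac{(1-|w|)^2(1-|a|)^2\, dm(z)\,dm(w)}{|1-\overline z w|^4\, |1- \overline w a|^4}.$$ The notation $X \asymp Y$ means that there are constants $0 < c \leq C < \infty$, depending only on $p$ and $\alpha$ (not on $F$), with $cX \leq Y \leq CX$; values $+\infty$ are allowed, so one side is infinite if and only if the other is. Conventions: $\omega^{-\alpha'} = +\infty$ where $\omega = 0$, $0\cdot\infty = 0$, and $\inf\emptyset = +\infty$. *)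

theory Defs
  imports "HOL-Complex_Analysis.Complex_Analysis"
begin

abbreviation unit_disc :: "complex set" where
  "unit_disc \<equiv> ball 0 1"

text \<open>Powers with real exponent on \<open>[0, \<infinity>]\<close>. For negative exponents \<open>0\<close> and \<open>\<infinity>\<close> are
  interchanged; this differs from \<open>powr\<close> on the reals, where \<open>0 powr s = 0\<close> for all \<open>s\<close>.\<close>

definition ennreal_pow :: "ennreal \<Rightarrow> real \<Rightarrow> ennreal" where
  "ennreal_pow x s =
     (if s = 0 then 1
      else if x = 0 then (if s < 0 then \<infinity> else 0)
      else if x = \<infinity> then (if s < 0 then 0 else \<infinity>)
      else ennreal (enn2real x powr s))"

definition bloch_seminorm :: "(complex \<Rightarrow> complex) \<Rightarrow> ennreal" where
  "bloch_seminorm F = (SUP z\<in>unit_disc. ennreal (cmod (deriv F z) * (1 - cmod z)))"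

text \<open>Lebesgue measure on \<open>complex \<times> complex\<close> is the completed product of the planar
  area measures (not normalised).\<close>

definition mu :: "complex \<Rightarrow> (complex \<times> complex) measure" where
  "mu a = density (lebesgue_on (unit_disc \<times> unit_disc))
     (\<lambda>(z, w). ennreal ((1 - cmod w)\<^sup>2 * (1 - cmod a)\<^sup>2 /
                 (cmod (1 - cnj z * w) ^ 4 * cmod (1 - cnj w * a) ^ 4)))"

text \<open>The functions \<open>\<omega>\<close> are finite-valued and Lebesgue measurable; their values outside
  \<open>unit_disc \<times> unit_disc\<close> are irrelevant. The convention \<open>0 \<cdot> \<infinity> = 0\<close> is that of type
  \<open>ennreal\<close>. The parameter \<open>q\<close> stands for the conjugate exponent.\<close>

definition S3 :: "real \<Rightarrow> real \<Rightarrow> (complex \<Rightarrow> complex) \<Rightarrow> (complex \<times> complex \<Rightarrow> real) set" where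
  "S3 p q F =
     {\<omega>. \<omega> \<in> borel_measurable (lebesgue_on (unit_disc \<times> unit_disc)) \<and>
          (\<forall>x\<in>unit_disc \<times> unit_disc. 0 \<le> \<omega> x) \<and>
          (SUP a\<in>unit_disc. \<integral>\<^sup>+(z, w).
             ennreal_pow (ennreal (cmod (deriv F z))) (q * (p - 1)) *
             ennreal_pow (ennreal (\<omega> (z, w))) (- q) *
             ennreal_pow (ennreal (1 - cmod z)) (p * q) \<partial>mu a) \<le> 1}"

definition S3_functional ::
    "real \<Rightarrow> (complex \<Rightarrow> complex) \<Rightarrow> (complex \<times> complex \<Rightarrow> real) \<Rightarrow> ennreal" where
  "S3_functional \<alpha> F \<omega> =
     (SUP a\<in>unit_disc.
        ennreal_pow
          (\<integral>\<^sup>+(z, w). ennreal_pow (ennreal (\<omega> (z, w))) \<alpha> *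
                        ennreal_pow (ennreal (cmod (deriv F z))) \<alpha> \<partial>mu a)
          (1 / \<alpha>))"

end

theory Submission
  imports Defs
begin

text \<open>The quantity \<open>\<integral>\<integral> f d\<mu>\<^sub>a\<close> is, up to constants, the twice iterated Berezin transform of
  \<open>f\<close> at \<open>a\<close>. Two properties of it carry the proof.

  \<^item> The measures \<open>\<mu>\<^sub>a\<close> have uniformly bounded mass (\<open>emeasure_mu_le\<close>). If
    \<open>N = \<parallel>F\<parallel>\<^sub>\<B>\<close> is finite, the weight \<open>\<omega>(z, w) = k |F'(z)|\<^bsup>p-1\<^esup> (1 - |z|)\<^bsup>p\<^esup>\<close> turns the
    integrand of the constraint into the constant \<open>k\<^bsup>-\<alpha>'\<^esup>\<close> off the zeros of \<open>F'\<close>, and makes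
    \<open>\<omega> |F'| = k (|F'(z)| (1 - |z|))\<^bsup>p\<^esup>\<close> at most \<open>k N\<^bsup>p\<^esup>\<close>. With \<open>k\<close> chosen by the mass bound the
    weight is admissible, and the functional is bounded by a constant times \<open>N\<^bsup>p\<^esup>\<close>
    (\<open>admissible_weight_with_small_functional\<close>).

  \<^item> The integrals of \<open>(|F'(z)| (1 - |z|))\<^bsup>p\<^esup>\<close> against \<open>\<mu>\<^sub>a\<close> dominate \<open>N\<^bsup>p\<^esup>\<close>
    (\<open>bloch_term_le_mu_integral\<close>), since \<open>d\<mu>\<^sub>a\<close> is at least of order \<open>(1 - |a|)\<^bsup>-4\<^esup>\<close> when \<open>z\<close> and
    \<open>w\<close> are within \<open>(1 - |a|) / 2\<close> of \<open>a\<close>. For any admissible \<open>\<omega>\<close>, Hoelder's inequality for the factors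
    \<open>\<omega> |F'|\<close> and \<open>|F'|\<^bsup>p-1\<^esup> \<omega>\<^sup>-\<^sup>1 (1 - |z|)\<^bsup>p\<^esup>\<close> bounds these integrals by the functional
    (\<open>mu_integral_le_functional_bound\<close>), which gives the other inequality.

  The local lower bound on \<open>|F'|\<close> needed in the second part comes from a point-picking argument
  (\<open>analytic_point_picking\<close>) in place of subharmonicity. Choose \<open>a\<close> to maximise
  \<open>|F'(z)| (r - |z|)\<close> over a disc of radius \<open>r < 1\<close>; then \<open>F'\<close> is bounded by \<open>2 |F'(a)|\<close> near \<open>a\<close>,
  so by Cauchy's estimate it cannot drop below \<open>|F'(a)| / 2\<close> on a ball of radius comparable to \<open>r - |a|\<close>. As
  \<open>r < 1\<close>, this works equally for \<open>N = \<infinity>\<close>. The ball may be much smaller than \<open>1 - |a|\<close>,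
  which costs a factor \<open>((r - |a|) / (1 - |a|))\<^sup>2\<close>; it is absorbed because \<open>p \<ge> \<alpha>' > 2\<close>.\<close>

section \<open>Real powers on the extended half-line\<close>

lemma ennreal_pow_ennreal:
  assumes "0 \<le> x" "0 < s"
  shows "ennreal_pow (ennreal x) s = ennreal (x powr s)"
  using assms by (cases "x = 0") (auto simp: ennreal_pow_def)

lemma ennreal_pow_ennreal_pos:
  assumes "0 < x"
  shows "ennreal_pow (ennreal x) s = ennreal (x powr s)"
  using assms by (auto simp: ennreal_pow_def)

lemma ennreal_pow_mono:
  assumes "0 < s" "x \<le> y"
  shows "ennreal_pow x s \<le> ennreal_pow y s"
proof (cases y)
  case (real v)
  moreover obtain u where "x = ennreal u" "0 \<le> u"
    using assms(2) real by (cases x) (auto simp: top_unique)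
  ultimately show ?thesis
    using assms by (auto simp: ennreal_pow_ennreal intro!: ennreal_leI powr_mono2)
next
  case top
  then show ?thesis using assms by (auto simp: ennreal_pow_def)
qed

lemma le_powr_of_ennreal_pow_le:
  assumes "0 < s" "0 \<le> b" "ennreal_pow x s \<le> ennreal b"
  shows "x \<le> ennreal (b powr (1 / s))"
proof (cases x)
  case (real u)
  then have "u powr s \<le> b"
    using assms by (simp add: ennreal_pow_ennreal)
  then have "(u powr s) powr (1 / s) \<le> b powr (1 / s)"
    using assms by (intro powr_mono2) auto
  then show ?thesis
    using real assms by (auto simp: powr_powr intro!: ennreal_leI)
next
  case top
  then show ?thesis
    using assms by (auto simp: ennreal_pow_def top_unique)
qed

lemma measurable_ennreal_pow [measurable]:
  "(\<lambda>x. ennreal_pow x s) \<in> borel_measurable borel"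
  unfolding ennreal_pow_def by measurable

section \<open>Uniform integrability of the Berezin kernel\<close>

lemma borel_measurable_cnj [measurable (raw)]:
  "f \<in> borel_measurable M \<Longrightarrow> (\<lambda>x. cnj (f x)) \<in> borel_measurable M"
  by (rule borel_measurable_continuous_on[OF continuous_on_cnj[OF continuous_on_id]])

text \<open>With \<open>1 - |a|\<close> in place of \<open>1 - |a|\<^sup>2\<close> and without normalisation, this is the kernel of
  the Berezin transform; the density of \<open>\<mu>\<^sub>a\<close> is a product of two such kernels.\<close>

definition berezin_kernel :: "complex \<Rightarrow> complex \<Rightarrow> real" where
  "berezin_kernel a w = (1 - cmod a)\<^sup>2 / cmod (1 - cnj w * a) ^ 4"

lemma one_minus_cmod_le:
  assumes "cmod a < 1" "cmod w \<le> 1"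
  shows "1 - cmod a \<le> cmod (1 - cnj w * a)"
proof -
  have "cmod (cnj w * a) \<le> 1 * cmod a"
    unfolding norm_mult by (intro mult_right_mono) (use assms in auto)
  moreover have "1 - cmod (cnj w * a) \<le> cmod (1 - cnj w * a)"
    by (metis norm_one norm_triangle_ineq2)
  ultimately show ?thesis by simp
qed

lemma emeasure_complex_ball: "r \<ge> 0 \<Longrightarrow> emeasure lborel (ball (c::complex) r) = ennreal (pi * r\<^sup>2)"
  by (simp add: emeasure_ball unit_ball_vol_2)

text \<open>For \<open>a\<close> away from the origin, \<open>|1 - cnj w * a| = |a| |1 / cnj a - w|\<close>, so the sublevel set lies in a
  ball around the reflection of \<open>a\<close> in the unit circle; for \<open>|a| \<le> 1/2\<close> the lower bound on \<open>s\<close>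
  makes the right-hand side at least the area of the whole disc.\<close>

lemma emeasure_kernel_sublevel:
  assumes "cmod a < 1" "1 - cmod a \<le> s"
  shows "emeasure lborel {w \<in> unit_disc. cmod (1 - cnj w * a) < s} \<le> ennreal (4 * pi * s\<^sup>2)"
proof (cases "cmod a \<le> 1 / 2")
  case True
  then have s: "1 / 2 \<le> s" using assms by simp
  have "1 \<le> 4 * s\<^sup>2" using s power_mono[OF s, of 2] by (simp add: power2_eq_square)
  have "emeasure lborel {w \<in> unit_disc. cmod (1 - cnj w * a) < s} \<le> emeasure lborel (unit_disc)"
    by (intro emeasure_mono) auto
  also have "\<dots> = ennreal pi" by (simp add: emeasure_complex_ball)
  also have "\<dots> \<le> ennreal (4 * pi * s\<^sup>2)"
    using mult_left_mono[OF \<open>1 \<le> 4 * s\<^sup>2\<close>, of pi] by (intro ennreal_leI) (auto simp: mult_ac)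
  finally show ?thesis .
next
  case False
  then have a: "a \<noteq> 0" "1 / 2 < cmod a" by auto
  have "{w \<in> unit_disc. cmod (1 - cnj w * a) < s} \<subseteq> ball (1 / cnj a) (2 * s)"
  proof
    fix w assume w: "w \<in> {w \<in> unit_disc. cmod (1 - cnj w * a) < s}"
    have "cmod (1 - cnj w * a) = cmod (cnj (1 - cnj w * a))" by (simp only: complex_mod_cnj)
    also have "cnj (1 - cnj w * a) = cnj a * (1 / cnj a - w)"
      using a by (simp add: field_simps)
    finally have "cmod a * cmod (1 / cnj a - w) < s"
      using w by (simp add: norm_mult)
    moreover have "1 / 2 * cmod (1 / cnj a - w) \<le> cmod a * cmod (1 / cnj a - w)"
      using a by (intro mult_right_mono) auto
    ultimately show "w \<in> ball (1 / cnj a) (2 * s)" by (simp add: dist_norm)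
  qed
  then have "emeasure lborel {w \<in> unit_disc. cmod (1 - cnj w * a) < s}
      \<le> emeasure lborel (ball (1 / cnj a) (2 * s))"
    by (intro emeasure_mono) auto
  also have "\<dots> = ennreal (4 * pi * s\<^sup>2)"
    using assms by (subst emeasure_complex_ball) (auto simp: power2_eq_square mult_ac)
  finally show ?thesis .
qed

lemma dyadic_scale:
  fixes t :: real
  assumes "1 \<le> t"
  obtains k :: nat where "2 ^ k \<le> t" "t < 2 ^ Suc k"
proof -
  obtain n :: nat where "t < 2 ^ n" using real_arch_pow[of 2 t] by auto
  define m where "m = (LEAST n::nat. t < 2 ^ n)"
  have m: "t < 2 ^ m" unfolding m_def by (rule LeastI) fact
  have "m \<noteq> 0" using m assms by (auto intro!: Nat.gr0I)
  then obtain k where k: "m = Suc k" by (cases m) auto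
  have "\<not> t < 2 ^ k" using not_less_Least[of k "\<lambda>n. t < 2 ^ n"] k m_def by auto
  then show ?thesis using m k by (intro that[of k]) auto
qed

lemma ennreal_le_suminf: "f k \<le> (\<Sum>k. f k :: ennreal)"
  using sum_le_suminf[of f "{k}"] by simp

text \<open>Decompose the disc into the dyadic shells where \<open>|1 - cnj w * a|\<close> is comparable to
  \<open>2\<^bsup>k\<^esup> (1 - |a|)\<close>: on the \<open>k\<close>-th shell the kernel is of order \<open>16\<^bsup>-k\<^esup> (1 - |a|)\<^bsup>-2\<^esup>\<close>, while the area is
  of order \<open>4\<^bsup>k\<^esup> (1 - |a|)\<^sup>2\<close>, so the contributions form a geometric series.\<close>

lemma nn_integral_berezin_kernel:
  assumes "cmod a < 1"
  shows "(\<integral>\<^sup>+w\<in>unit_disc. ennreal (berezin_kernel a w) \<partial>lborel) \<le> ennreal (64 * pi / 3)"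
proof -
  define d where "d = 1 - cmod a"
  have d: "d > 0" using assms by (simp add: d_def)
  define E where "E k = {w \<in> unit_disc. cmod (1 - cnj w * a) < 2 ^ Suc k * d}" for k :: nat
  have [measurable]: "E k \<in> sets borel" for k
    unfolding E_def mem_ball by (intro borel_open open_Collect_conj open_Collect_less continuous_intros)
  define b where "b k = d\<^sup>2 / (2 ^ k * d) ^ 4" for k :: nat
  have b: "b k \<ge> 0" for k by (simp add: b_def)
  have "(\<integral>\<^sup>+w\<in>unit_disc. ennreal (berezin_kernel a w) \<partial>lborel)
      \<le> (\<integral>\<^sup>+w. (\<Sum>k. ennreal (b k) * indicator (E k) w) \<partial>lborel)"
  proof (intro nn_integral_mono)
    fix w :: complex
    show "ennreal (berezin_kernel a w) * indicator unit_disc w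
        \<le> (\<Sum>k. ennreal (b k) * indicator (E k) w)"
    proof (cases "w \<in> unit_disc")
      case True
      define t where "t = cmod (1 - cnj w * a)"
      have dt: "d \<le> t" using one_minus_cmod_le[OF assms, of w] True by (simp add: d_def t_def)
      then obtain k where k: "2 ^ k \<le> t / d" "t / d < 2 ^ Suc k"
        using d by (elim dyadic_scale[of "t / d", rotated]) (auto simp: field_simps)
      have "w \<in> E k" using k True d by (simp add: E_def t_def[symmetric] pos_divide_less_eq)
      have "berezin_kernel a w = d\<^sup>2 / t ^ 4" by (simp add: berezin_kernel_def d_def t_def)
      also have "\<dots> \<le> b k"
        unfolding b_def using k d dt
        by (intro divide_left_mono power_mono mult_pos_pos zero_less_power) (auto simp: field_simps)
      finally have "ennreal (berezin_kernel a w) * indicator unit_disc w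
          \<le> ennreal (b k) * indicator (E k) w"
        using \<open>w \<in> E k\<close> True by (auto intro!: ennreal_leI)
      also have "\<dots> \<le> (\<Sum>k. ennreal (b k) * indicator (E k) w)"
        by (rule ennreal_le_suminf)
      finally show ?thesis .
    qed auto
  qed
  also have "\<dots> = (\<Sum>k. \<integral>\<^sup>+w. ennreal (b k) * indicator (E k) w \<partial>lborel)"
    by (rule nn_integral_suminf) measurable
  also have "\<dots> = (\<Sum>k. ennreal (b k) * emeasure lborel (E k))"
    by (simp add: nn_integral_cmult_indicator)
  also have "\<dots> \<le> (\<Sum>k. ennreal (16 * pi * (1 / 4) ^ k))"
  proof (intro suminf_le)
    fix k
    have "1 * d \<le> 2 ^ Suc k * d" using d by (intro mult_right_mono) (auto simp: one_le_power simp del: power_Suc)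
    then have "ennreal (b k) * emeasure lborel (E k)
        \<le> ennreal (b k) * ennreal (4 * pi * (2 ^ Suc k * d)\<^sup>2)"
      unfolding E_def d_def
      by (intro mult_left_mono emeasure_kernel_sublevel assms) auto
    also have "\<dots> = ennreal (b k * (4 * pi * (2 ^ Suc k * d)\<^sup>2))"
      using b by (simp add: ennreal_mult)
    also have "b k * (4 * pi * (2 ^ Suc k * d)\<^sup>2) = 16 * pi * (1 / 4) ^ k"
    proof -
      have "(4::real) ^ k = (2 ^ k)\<^sup>2" by (simp add: power2_eq_square flip: power_mult_distrib)
      then show ?thesis
        unfolding b_def using d
        by (simp add: power_divide field_simps power2_eq_square power4_eq_xxxx)
    qed
    finally show "ennreal (b k) * emeasure lborel (E k) \<le> ennreal (16 * pi * (1 / 4) ^ k)" .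
  qed auto
  also have "\<dots> = ennreal (\<Sum>k. 16 * pi * (1 / 4) ^ k)"
    by (intro suminf_ennreal2 summable_mult summable_geometric) auto
  also have "(\<Sum>k. 16 * pi * (1 / 4) ^ k) = 64 * pi / 3"
    by (subst suminf_mult) (auto simp: suminf_geometric summable_geometric)
  finally show ?thesis .
qed

section \<open>Point picking\<close>

text \<open>The weighted maximum principle that replaces subharmonicity: from an arbitrary point \<open>z0\<close> one
  passes to a point \<open>a\<close> at which \<open>|g(a)|\<close> controls \<open>|g|\<close> from below on a ball of radius \<open>\<epsilon>\<close>, without
  losing more than a constant in \<open>|g(z0)| (1 - |z0|)\<close>. The conclusion involves \<open>\<epsilon> |g(a)|\<close>
  rather than \<open>(1 - |a|) |g(a)|\<close> because, unless \<open>g(z0) = 0\<close>, \<open>a\<close> is a maximum point of \<open>|g(z)| (r - |z|)\<close> on a smaller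
  disc of radius \<open>r\<close>, and \<open>\<epsilon>\<close> is proportional to \<open>r - |a|\<close>.\<close>

lemma analytic_point_picking:
  assumes g: "g holomorphic_on unit_disc" and z0: "cmod z0 < 1"
  obtains a \<epsilon> where "cmod a < 1" "0 < \<epsilon>" "16 * \<epsilon> \<le> 1 - cmod a"
    "cmod (g z0) * (1 - cmod z0) \<le> 32 * \<epsilon> * cmod (g a)"
    "\<And>z. z \<in> ball a \<epsilon> \<Longrightarrow> cmod (g a) / 2 \<le> cmod (g z)"
proof (cases "g z0 = 0")
  case True
  then show ?thesis
    using z0 by (intro that[of z0 "(1 - cmod z0) / 16"]) auto
next
  case False
  \<comment> \<open>Any \<open>r\<close> between \<open>|z0|\<close> and \<open>1\<close> makes the maximum finite; the midpoint costs a factor \<open>2\<close>.\<close>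
  define r where "r = (1 + cmod z0) / 2"
  have r: "cmod z0 < r" "r < 1" "0 < r" using z0 by (auto simp: r_def intro: add_pos_nonneg)
  have sub: "cball 0 r \<subseteq> (unit_disc :: complex set)" using r by auto
  have cont: "continuous_on (cball 0 r) (\<lambda>z. cmod (g z) * (r - cmod z))"
    by (intro continuous_intros holomorphic_on_imp_continuous_on holomorphic_on_subset[OF g] sub)
  obtain a where a: "a \<in> cball 0 r"
    and amax: "\<And>z. z \<in> cball 0 r \<Longrightarrow> cmod (g z) * (r - cmod z) \<le> cmod (g a) * (r - cmod a)"
    using continuous_attains_sup[OF compact_cball _ cont] r by auto
  have "0 < cmod (g z0) * (r - cmod z0)" using False r by simp
  also have "\<dots> \<le> cmod (g a) * (r - cmod a)" using r by (intro amax) auto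
  finally have pos: "0 < cmod (g a) * (r - cmod a)" .
  then have ra: "cmod a < r" using a by (auto simp: zero_less_mult_iff)
  define \<rho> where "\<rho> = (r - cmod a) / 2"
  have \<rho>: "0 < \<rho>" "r - cmod a = 2 * \<rho>" using ra by (auto simp: \<rho>_def)
  \<comment> \<open>On this ball the weight \<open>r - |z|\<close> is at least half its value at \<open>a\<close>, so maximality of \<open>a\<close>
    bounds \<open>|g|\<close>.\<close>
  have bnd: "cmod (g z) \<le> 2 * cmod (g a)" and inr: "z \<in> cball 0 r" if "z \<in> cball a \<rho>" for z
  proof -
    have "cmod z \<le> cmod a + \<rho>"
      using that norm_triangle_ineq2[of z a] by (auto simp: dist_norm norm_minus_commute)
    then have z: "\<rho> \<le> r - cmod z" using \<rho> by simp
    then show "z \<in> cball 0 r" using \<rho> by auto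
    then have "cmod (g z) * (r - cmod z) \<le> cmod (g a) * (2 * \<rho>)" using amax \<rho> by metis
    moreover have "cmod (g z) * \<rho> \<le> cmod (g z) * (r - cmod z)" by (intro mult_left_mono z) auto
    ultimately have "cmod (g z) * \<rho> \<le> (2 * cmod (g a)) * \<rho>" by simp
    then show "cmod (g z) \<le> 2 * cmod (g a)" using \<rho> by simp
  qed
  have der: "cmod (deriv g z) \<le> 4 * cmod (g a) / \<rho>" if z: "z \<in> cball a (\<rho> / 2)" for z
  proof -
    have s: "cball z (\<rho> / 2) \<subseteq> cball a \<rho>"
    proof
      fix x assume "x \<in> cball z (\<rho> / 2)"
      then show "x \<in> cball a \<rho>" using z dist_triangle[of a x z] by auto
    qed
    have s': "cball z (\<rho> / 2) \<subseteq> unit_disc" using s inr sub by blast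
    have "cmod ((deriv ^^ 1) g z) \<le> fact 1 * (2 * cmod (g a)) / (\<rho> / 2) ^ 1"
    proof (rule Cauchy_inequality)
      show "g holomorphic_on ball z (\<rho> / 2)"
        using g s' by (meson ball_subset_cball holomorphic_on_subset)
      show "continuous_on (cball z (\<rho> / 2)) g"
        using g s' by (meson holomorphic_on_imp_continuous_on holomorphic_on_subset)
      show "cmod (g x) \<le> 2 * cmod (g a)" if "cmod (z - x) = \<rho> / 2" for x
        using that s by (intro bnd) (auto simp: dist_norm)
    qed (use \<rho> in auto)
    then show ?thesis by simp
  qed
  show ?thesis
  proof (rule that[of a "\<rho> / 8"])
    show "cmod a < 1" "0 < \<rho> / 8" "16 * (\<rho> / 8) \<le> 1 - cmod a"
      using ra r \<rho> by auto
    have "cmod (g z0) * (r - cmod z0) \<le> cmod (g a) * (2 * \<rho>)" using amax[of z0] r \<rho> by auto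
    moreover have "r - cmod z0 = (1 - cmod z0) / 2" by (simp add: r_def field_simps)
    ultimately show "cmod (g z0) * (1 - cmod z0) \<le> 32 * (\<rho> / 8) * cmod (g a)" by (simp add: mult_ac)
    fix z assume z: "z \<in> ball a (\<rho> / 8)"
    have "cmod (g z - g a) \<le> 4 * cmod (g a) / \<rho> * cmod (z - a)"
    proof (rule field_differentiable_bound[where S = "cball a (\<rho> / 2)" and f = g and f' = "deriv g"])
      fix x assume x: "x \<in> cball a (\<rho> / 2)"
      then have "x \<in> cball a \<rho>" using \<rho> by auto
      then have "x \<in> unit_disc" using inr sub by blast
      then show "(g has_field_derivative deriv g x) (at x within cball a (\<rho> / 2))"
        by (rule holomorphic_derivI[OF g open_ball])
      show "cmod (deriv g x) \<le> 4 * cmod (g a) / \<rho>" by (rule der[OF x])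
    next
      show "z \<in> cball a (\<rho> / 2)" "a \<in> cball a (\<rho> / 2)"
        using z \<rho> unfolding mem_ball mem_cball dist_self by linarith+
    qed (rule convex_cball)
    also have "\<dots> \<le> 4 * cmod (g a) / \<rho> * (\<rho> / 8)"
      using z \<rho> by (intro mult_left_mono) (auto simp: dist_norm norm_minus_commute)
    also have "\<dots> = cmod (g a) / 2" using \<rho> by simp
    finally have "cmod (g z - g a) \<le> cmod (g a) / 2" .
    then show "cmod (g a) / 2 \<le> cmod (g z)"
      using norm_triangle_ineq2[of "g a" "g z"] by (simp add: norm_minus_commute)
  qed
qed

section \<open>The measures \<open>\<mu>\<^sub>a\<close>\<close>

lemma mu_eq_density:
  "mu a = density (lebesgue_on (unit_disc \<times> unit_disc))
     (\<lambda>x. ennreal (berezin_kernel (snd x) (fst x) * berezin_kernel a (snd x)))"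
  unfolding mu_def berezin_kernel_def by (simp add: case_prod_unfold times_divide_times_eq)

lemma space_mu [simp]: "space (mu a) = unit_disc \<times> unit_disc"
  by (simp add: mu_eq_density)

lemma sets_mu [measurable_cong]: "sets (mu a) = sets (lebesgue_on (unit_disc \<times> unit_disc))"
  by (simp add: mu_eq_density)

lemma Times_in_sets_borel: "A \<in> sets borel \<Longrightarrow> B \<in> sets borel \<Longrightarrow> A \<times> B \<in> sets (borel :: (complex \<times> complex) measure)"
  unfolding borel_prod[symmetric] by (rule pair_measureI)

lemma bidisc_in_sets_lebesgue: "unit_disc \<times> unit_disc \<in> sets (lebesgue :: (complex \<times> complex) measure)"
  using Times_in_sets_borel[of unit_disc unit_disc] by (intro sets_completionI_sets) auto

lemma borel_measurable_berezin_density [measurable]: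
  "(\<lambda>x. ennreal (berezin_kernel (snd x) (fst x) * berezin_kernel a (snd x)))
     \<in> borel_measurable borel"
  unfolding berezin_kernel_def borel_prod[symmetric] by measurable

lemma measurable_lebesgue_on_borel:
  "f \<in> borel_measurable borel \<Longrightarrow> f \<in> borel_measurable (lebesgue_on S)"
  by (intro measurable_restrict_space1 measurable_completion) auto

text \<open>Passing from the completed measure to \<open>lborel\<close> makes Tonelli's theorem for the product of the
  two area measures applicable.\<close>

lemma nn_integral_mu:
  assumes "f \<in> borel_measurable (mu a)"
  shows "(\<integral>\<^sup>+x. f x \<partial>mu a) =
    (\<integral>\<^sup>+x. ennreal (berezin_kernel (snd x) (fst x) * berezin_kernel a (snd x)) * f x *
       indicator (unit_disc \<times> unit_disc) x \<partial>lborel)"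
proof -
  have "f \<in> borel_measurable (lebesgue_on (unit_disc \<times> unit_disc))"
    using assms by (simp add: measurable_cong_sets[OF sets_mu refl])
  then show ?thesis
    unfolding mu_eq_density
    by (simp add: nn_integral_density measurable_lebesgue_on_borel nn_integral_restrict_space
        bidisc_in_sets_lebesgue nn_integral_completion)
qed

text \<open>Integrate over \<open>z\<close> first: the inner integral is that of \<open>berezin_kernel w\<close>, which is bounded
  uniformly in \<open>w\<close>, and what remains is the integral of \<open>berezin_kernel a\<close>.\<close>

lemma emeasure_mu_le:
  assumes "cmod a < 1"
  shows "emeasure (mu a) (unit_disc \<times> unit_disc) \<le> ennreal ((64 * pi / 3)\<^sup>2)"
proof -
  let ?K = "ennreal (64 * pi / 3)"
  have kpos: "0 \<le> berezin_kernel u v" for u v by (simp add: berezin_kernel_def)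
  have [measurable]: "(\<lambda>x. ennreal (berezin_kernel (snd x) (fst x) * berezin_kernel a (snd x)))
     \<in> borel_measurable (lborel \<Otimes>\<^sub>M lborel)"
    using borel_measurable_berezin_density[of a] by (simp add: lborel_prod)
  have [measurable]: "berezin_kernel u \<in> borel_measurable borel" for u
    unfolding berezin_kernel_def by measurable
  have km: "(\<lambda>w. ennreal (berezin_kernel u w) * indicator unit_disc w) \<in> borel_measurable lborel" for u
    by (rule borel_measurable_times_ennreal[OF _ borel_measurable_indicator]) auto
  have "emeasure (mu a) (unit_disc \<times> unit_disc) = (\<integral>\<^sup>+x. 1 \<partial>mu a)"
    unfolding space_mu[of a, symmetric] by (subst nn_integral_const) simp
  also have "\<dots> = (\<integral>\<^sup>+x. ennreal (berezin_kernel (snd x) (fst x) * berezin_kernel a (snd x)) *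
       indicator (unit_disc \<times> unit_disc) x \<partial>(lborel \<Otimes>\<^sub>M lborel))"
    by (subst nn_integral_mu) (auto simp: lborel_prod)
  also have "\<dots> = (\<integral>\<^sup>+w. \<integral>\<^sup>+z. ennreal (berezin_kernel w z * berezin_kernel a w) *
       indicator (unit_disc \<times> unit_disc) (z, w) \<partial>lborel \<partial>lborel)"
    by (subst lborel_pair.nn_integral_snd[symmetric]) auto
  also have "\<dots> = (\<integral>\<^sup>+w. \<integral>\<^sup>+z. (ennreal (berezin_kernel a w) * indicator unit_disc w) *
       (ennreal (berezin_kernel w z) * indicator unit_disc z) \<partial>lborel \<partial>lborel)"
    by (intro nn_integral_cong) (auto simp: ennreal_mult kpos mult_ac indicator_times)
  also have "\<dots> = (\<integral>\<^sup>+w. (ennreal (berezin_kernel a w) * indicator unit_disc w) *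
       (\<integral>\<^sup>+z\<in>unit_disc. ennreal (berezin_kernel w z) \<partial>lborel) \<partial>lborel)"
    by (intro nn_integral_cong nn_integral_cmult km)
  also have "\<dots> \<le> (\<integral>\<^sup>+w. (ennreal (berezin_kernel a w) * indicator unit_disc w) * ?K \<partial>lborel)"
  proof (rule nn_integral_mono)
    fix w :: complex
    show "ennreal (berezin_kernel a w) * indicator unit_disc w *
        (\<integral>\<^sup>+z\<in>unit_disc. ennreal (berezin_kernel w z) \<partial>lborel)
      \<le> ennreal (berezin_kernel a w) * indicator unit_disc w * ?K"
    proof (cases "cmod w < 1")
      case True
      then show ?thesis by (intro mult_left_mono nn_integral_berezin_kernel) auto
    qed simp
  qed
  also have "\<dots> = (\<integral>\<^sup>+w\<in>unit_disc. ennreal (berezin_kernel a w) \<partial>lborel) * ?K"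
    by (rule nn_integral_multc[OF km])
  also have "\<dots> \<le> ?K * ?K"
    by (intro mult_right_mono nn_integral_berezin_kernel assms) auto
  also have "\<dots> = ennreal ((64 * pi / 3)\<^sup>2)"
    by (simp add: power2_eq_square flip: ennreal_mult)
  finally show ?thesis .
qed

text \<open>Near \<open>a\<close> all the factors are comparable to \<open>d = 1 - |a|\<close>: \<open>1 - |w| \<ge> d/2\<close>, while
  \<open>|1 - cnj z * w|\<close> and \<open>|1 - cnj w * a|\<close> differ from \<open>1 - |a|\<^sup>2 \<le> 2 d\<close> by at most \<open>d\<close>. The
  constant is \<open>4 \<cdot> 3\<^sup>8 = 26244\<close>.\<close>

lemma density_mu_ge:
  assumes a: "cmod a < 1" and z: "z \<in> ball a ((1 - cmod a) / 2)"
    and w: "w \<in> ball a ((1 - cmod a) / 2)"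
  shows "1 / (26244 * (1 - cmod a) ^ 4) \<le> berezin_kernel w z * berezin_kernel a w"
proof -
  define d where "d = 1 - cmod a"
  have d: "0 < d" "d \<le> 1" using a by (auto simp: d_def)
  have dz: "cmod (z - a) \<le> d / 2" "cmod (w - a) \<le> d / 2" using z w by (auto simp: d_def dist_norm norm_minus_commute)
  have nz: "cmod z < 1" "cmod w < 1" "d / 2 \<le> 1 - cmod w"
    using dz d norm_triangle_ineq2[of z a] norm_triangle_ineq2[of w a] by (auto simp: d_def)
  have aa: "cmod (1 - cnj a * a) \<le> 2 * d"
  proof -
    have "1 - cnj a * a = of_real (1 - (cmod a)\<^sup>2)"
      by (simp add: complex_norm_square mult.commute del: of_real_power)
    then have "cmod (1 - cnj a * a) = \<bar>1 - (cmod a)\<^sup>2\<bar>" by (simp only: norm_of_real)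
    also have "\<dots> = 1 - (cmod a)\<^sup>2" using a by (simp add: power_le_one)
    also have "\<dots> = (1 + cmod a) * d" by (simp add: d_def power2_eq_square algebra_simps)
    also have "\<dots> \<le> 2 * d" using d a by (intro mult_right_mono) auto
    finally show ?thesis .
  qed
  have 1: "cmod (1 - cnj z * w) \<le> 3 * d"
  proof -
    have "1 - cnj z * w = (1 - cnj a * a) - (cnj z * (w - a) + cnj (z - a) * a)"
      by (simp add: algebra_simps)
    then have "cmod (1 - cnj z * w) \<le> cmod (1 - cnj a * a) + cmod (cnj z * (w - a) + cnj (z - a) * a)"
      by (metis norm_triangle_ineq4)
    also have "cmod (cnj z * (w - a) + cnj (z - a) * a) \<le> cmod z * cmod (w - a) + cmod (z - a) * cmod a"
      by (metis norm_triangle_ineq norm_mult complex_mod_cnj)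
    also have "\<dots> \<le> 1 * (d / 2) + (d / 2) * 1"
      using nz dz a d by (intro add_mono mult_mono) auto
    finally show ?thesis using aa by simp
  qed
  have 2: "cmod (1 - cnj w * a) \<le> 3 * d"
  proof -
    have "1 - cnj w * a = (1 - cnj a * a) - cnj (w - a) * a"
      by (simp add: algebra_simps)
    then have "cmod (1 - cnj w * a) \<le> cmod (1 - cnj a * a) + cmod (cnj (w - a) * a)"
      by (metis norm_triangle_ineq4)
    also have "cmod (cnj (w - a) * a) = cmod (w - a) * cmod a" by (simp add: norm_mult del: complex_cnj_diff)
    also have "\<dots> \<le> (d / 2) * 1"
      using nz dz a d by (intro mult_mono) auto
    finally show ?thesis using aa d by simp
  qed
  have p1: "0 < cmod (1 - cnj z * w)" using one_minus_cmod_le[of w z] nz by linarith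
  have p2: "0 < cmod (1 - cnj w * a)" using one_minus_cmod_le[of a w] nz a by linarith
  have "1 / (26244 * d ^ 4) = ((d / 2)\<^sup>2 / (3 * d) ^ 4) * (d\<^sup>2 / (3 * d) ^ 4)"
    using d by (simp add: power_divide power_mult_distrib field_simps power2_eq_square power4_eq_xxxx)
  also have "\<dots> \<le> berezin_kernel w z * berezin_kernel a w"
    unfolding berezin_kernel_def d_def[symmetric]
    using nz d 1 2 p1 p2
    by (intro mult_mono frac_le power_mono zero_less_power) (simp_all add: less_imp_le[OF d(1)])
  finally show ?thesis by (simp add: d_def)
qed

text \<open>Only the product of the balls of radius \<open>\<epsilon>\<close> (for \<open>z\<close>) and \<open>(1 - |a|) / 2\<close> (for \<open>w\<close>) is
  used; its volume is \<open>\<pi>\<epsilon>\<^sup>2 \<cdot> \<pi>(1 - |a|)\<^sup>2 / 4\<close>.\<close>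

lemma nn_integral_mu_ge:
  assumes a: "cmod a < 1" and e: "0 < \<epsilon>" "\<epsilon> \<le> (1 - cmod a) / 2" and m: "0 \<le> m"
    and h: "h \<in> borel_measurable (mu a)"
    and hm: "\<And>z w. z \<in> ball a \<epsilon> \<Longrightarrow> w \<in> ball a ((1 - cmod a) / 2) \<Longrightarrow> ennreal m \<le> h (z, w)"
  shows "ennreal (pi\<^sup>2 * \<epsilon>\<^sup>2 * m / (104976 * (1 - cmod a)\<^sup>2)) \<le> (\<integral>\<^sup>+x. h x \<partial>mu a)"
proof -
  define d where "d = 1 - cmod a"
  define Q where "Q = ball a \<epsilon> \<times> ball a (d / 2)"
  have d: "0 < d" using a by (simp add: d_def)
  have Q: "Q \<in> sets lborel" using Times_in_sets_borel unfolding Q_def by simp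
  have "emeasure lborel Q = emeasure (lborel \<Otimes>\<^sub>M lborel) Q" by (simp add: lborel_prod)
  also have "\<dots> = emeasure lborel (ball a \<epsilon>) * emeasure lborel (ball a (d / 2))"
    unfolding Q_def by (intro lborel.emeasure_pair_measure_Times) auto
  also have "\<dots> = ennreal ((pi * \<epsilon>\<^sup>2) * (pi * (d / 2)\<^sup>2))"
    using e d by (simp add: emeasure_complex_ball ennreal_mult del: power_divide)
  finally have eQ: "emeasure lborel Q = ennreal ((pi * \<epsilon>\<^sup>2) * (pi * (d / 2)\<^sup>2))" .
  have "pi\<^sup>2 * \<epsilon>\<^sup>2 * m / (104976 * d\<^sup>2) = (1 / (26244 * d ^ 4) * m) * ((pi * \<epsilon>\<^sup>2) * (pi * (d / 2)\<^sup>2))"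
    using d by (simp add: power_divide field_simps power2_eq_square power4_eq_xxxx)
  then have "ennreal (pi\<^sup>2 * \<epsilon>\<^sup>2 * m / (104976 * d\<^sup>2)) = ennreal (1 / (26244 * d ^ 4) * m) * emeasure lborel Q"
    unfolding eQ using d m by (subst ennreal_mult[symmetric]) auto
  also have "\<dots> = (\<integral>\<^sup>+x. ennreal (1 / (26244 * d ^ 4) * m) * indicator Q x \<partial>lborel)"
    by (rule nn_integral_cmult_indicator[OF Q, symmetric])
  also have "\<dots> \<le> (\<integral>\<^sup>+x. ennreal (berezin_kernel (snd x) (fst x) * berezin_kernel a (snd x)) * h x *
       indicator (unit_disc \<times> unit_disc) x \<partial>lborel)"
  proof (intro nn_integral_mono)
    fix x :: "complex \<times> complex"
    show "ennreal (1 / (26244 * d ^ 4) * m) * indicator Q x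
      \<le> ennreal (berezin_kernel (snd x) (fst x) * berezin_kernel a (snd x)) * h x *
       indicator (unit_disc \<times> unit_disc) x"
    proof (cases "x \<in> Q")
      case True
      obtain z w where x: "x = (z, w)" by (cases x)
      have zw: "z \<in> ball a \<epsilon>" "w \<in> ball a (d / 2)" "z \<in> ball a (d / 2)"
        using True e by (auto simp: x Q_def d_def)
      have "cmod u < 1" if "u \<in> ball a (d / 2)" for u
        using that d norm_triangle_ineq2[of u a] by (auto simp: d_def dist_norm norm_minus_commute)
      then have "x \<in> unit_disc \<times> unit_disc" using zw by (auto simp: x)
      moreover have "ennreal (1 / (26244 * d ^ 4) * m) = ennreal (1 / (26244 * d ^ 4)) * ennreal m"
        using d m by (intro ennreal_mult) auto
      moreover have "\<dots> \<le> ennreal (berezin_kernel w z * berezin_kernel a w) * h (z, w)"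
        using zw a unfolding d_def by (intro mult_mono ennreal_leI density_mu_ge hm) auto
      ultimately show ?thesis using True by (simp add: x)
    qed auto
  qed
  also have "\<dots> = (\<integral>\<^sup>+x. h x \<partial>mu a)" by (rule nn_integral_mu[OF h, symmetric])
  finally show ?thesis by (simp add: d_def)
qed

lemma measurable_mu_continuous:
  fixes f :: "complex \<Rightarrow> real"
  assumes "continuous_on unit_disc f"
  shows "(\<lambda>x. f (fst x)) \<in> borel_measurable (mu a)"
proof -
  have "continuous_on (unit_disc \<times> unit_disc) (\<lambda>x. f (fst x))"
    by (rule continuous_on_compose2[OF assms]) (auto intro: continuous_intros)
  then have "(\<lambda>x. f (fst x)) \<in> borel_measurable (lebesgue_on (unit_disc \<times> unit_disc))"
    by (rule continuous_imp_measurable_on_sets_lebesgue[OF _ bidisc_in_sets_lebesgue])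
  then show ?thesis
    by (simp add: measurable_cong_sets[OF sets_mu refl])
qed

text \<open>The point \<open>a\<close> is the one produced by point picking, so it depends on \<open>z0\<close>. With
  \<open>d = 1 - |a|\<close>, the integral over the two balls is of order \<open>(|g(a)| d)\<^bsup>p\<^esup> (\<epsilon>/d)\<^sup>2\<close>, and this
  dominates \<open>(|g(a)| \<epsilon>)\<^bsup>p\<^esup>\<close> because \<open>\<epsilon> \<le> d\<close> and \<open>p \<ge> 2\<close>.\<close>

lemma bloch_term_le_mu_integral:
  assumes g: "g holomorphic_on unit_disc" and p: "2 \<le> p" and z0: "cmod z0 < 1"
  obtains a where "cmod a < 1"
    "ennreal (pi\<^sup>2 / 104976 / 128 powr p * (cmod (g z0) * (1 - cmod z0)) powr p)
       \<le> (\<integral>\<^sup>+x. ennreal ((cmod (g (fst x)) * (1 - cmod (fst x))) powr p) \<partial>mu a)"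
proof -
  obtain a \<epsilon> where a: "cmod a < 1" and e: "0 < \<epsilon>" "16 * \<epsilon> \<le> 1 - cmod a"
    and ga: "cmod (g z0) * (1 - cmod z0) \<le> 32 * \<epsilon> * cmod (g a)"
    and low: "\<And>z. z \<in> ball a \<epsilon> \<Longrightarrow> cmod (g a) / 2 \<le> cmod (g z)"
    using analytic_point_picking[OF g z0] by blast
  define d where "d = 1 - cmod a"
  have d: "0 < d" "\<epsilon> \<le> d" using a e by (auto simp: d_def)
  define m where "m = (cmod (g a) / 2 * (d / 2)) powr p"
  let ?h = "\<lambda>x. ennreal ((cmod (g (fst x)) * (1 - cmod (fst x))) powr p)"
  have "continuous_on unit_disc (\<lambda>z. cmod (g z) * (1 - cmod z))"
    by (intro continuous_intros holomorphic_on_imp_continuous_on g)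
  then have [measurable]: "(\<lambda>x. cmod (g (fst x)) * (1 - cmod (fst x))) \<in> borel_measurable (mu a)"
    by (rule measurable_mu_continuous)
  have "ennreal (pi\<^sup>2 * \<epsilon>\<^sup>2 * m / (104976 * d\<^sup>2)) \<le> (\<integral>\<^sup>+x. ?h x \<partial>mu a)"
    unfolding d_def
  proof (rule nn_integral_mu_ge)
    fix z w assume z: "z \<in> ball a \<epsilon>"
    have "d / 2 \<le> 1 - cmod z"
      using z e norm_triangle_ineq2[of z a] by (auto simp: d_def dist_norm norm_minus_commute)
    then have "cmod (g a) / 2 * (d / 2) \<le> cmod (g z) * (1 - cmod z)"
      using low[OF z] d by (intro mult_mono) auto
    then show "ennreal m \<le> ?h (z, w)"
      unfolding m_def using d p by (auto intro!: ennreal_leI powr_mono2)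
  qed (use a e in \<open>auto simp: m_def\<close>)
  moreover have "pi\<^sup>2 / 104976 / 128 powr p * (cmod (g z0) * (1 - cmod z0)) powr p
      \<le> pi\<^sup>2 * \<epsilon>\<^sup>2 * m / (104976 * d\<^sup>2)"
  proof -
    have m: "m = (cmod (g a) / 4) powr p * d powr p"
      unfolding m_def using d by (subst powr_mult[symmetric]) (auto simp: field_simps)
    have "\<epsilon> powr p = \<epsilon>\<^sup>2 * \<epsilon> powr (p - 2)"
      using e by (simp add: powr_diff powr_numeral)
    also have "\<dots> \<le> \<epsilon>\<^sup>2 * d powr (p - 2)"
      using e d p by (intro mult_left_mono powr_mono2) auto
    also have "\<dots> = \<epsilon>\<^sup>2 * d powr p / d\<^sup>2"
      using d by (simp add: powr_diff powr_numeral)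
    finally have ed: "\<epsilon> powr p \<le> \<epsilon>\<^sup>2 * d powr p / d\<^sup>2" .
    have "(cmod (g z0) * (1 - cmod z0)) powr p \<le> (32 * \<epsilon> * cmod (g a)) powr p"
      using z0 p by (intro powr_mono2 ga) auto
    also have "32 * \<epsilon> * cmod (g a) = 128 * ((cmod (g a) / 4) * \<epsilon>)" by simp
    also have "(128 * ((cmod (g a) / 4) * \<epsilon>)) powr p
        = 128 powr p * ((cmod (g a) / 4) powr p * \<epsilon> powr p)"
      using e by (simp only: powr_mult)
    also have "\<dots> \<le> 128 powr p * ((cmod (g a) / 4) powr p * (\<epsilon>\<^sup>2 * d powr p / d\<^sup>2))"
      by (intro mult_left_mono ed) auto
    also have "\<dots> = 128 powr p * (\<epsilon>\<^sup>2 * m / d\<^sup>2)" by (simp add: m)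
    finally have "(cmod (g z0) * (1 - cmod z0)) powr p / 128 powr p \<le> \<epsilon>\<^sup>2 * m / d\<^sup>2"
      by (simp add: field_simps)
    then have "pi\<^sup>2 / 104976 * ((cmod (g z0) * (1 - cmod z0)) powr p / 128 powr p)
       \<le> pi\<^sup>2 / 104976 * (\<epsilon>\<^sup>2 * m / d\<^sup>2)"
      by (intro mult_left_mono) auto
    then show ?thesis by (simp add: mult_ac)
  qed
  ultimately have "ennreal (pi\<^sup>2 / 104976 / 128 powr p * (cmod (g z0) * (1 - cmod z0)) powr p)
      \<le> (\<integral>\<^sup>+x. ?h x \<partial>mu a)"
    by (meson ennreal_leI order_trans)
  then show ?thesis by (rule that[OF a])
qed

section \<open>The Bloch seminorm is dominated by the functional\<close>

text \<open>The pointwise form of Hoelder's inequality: Young's inequality for the factors \<open>A = u x\<close> and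
  \<open>B = x\<^bsup>p-1\<^esup> u\<^sup>-\<^sup>1 \<delta>\<^bsup>p\<^esup>\<close>, of which \<open>A\<close> is scaled by \<open>t = S\<^bsup>-1/q\<^esup>\<close> and \<open>B\<close> by \<open>t\<^sup>-\<^sup>1\<close>. This scaling
  makes the right-hand side integrate to at most \<open>S\<close> when \<open>\<integral>A\<^bsup>\<alpha>\<^esup> \<le> S\<^bsup>\<alpha>\<^esup>\<close> and \<open>\<integral>B\<^bsup>q\<^esup> \<le> 1\<close>. In this
  pointwise form zeros of the weight need no exceptional sets: if \<open>u = 0 < x\<close> the right-hand side
  is infinite, and if \<open>x = 0\<close> the left-hand side vanishes.\<close>

lemma scaled_Young:
  fixes \<alpha> q p S x u \<delta> :: real
  assumes \<alpha>: "1 < \<alpha>" and q: "1 < q" and conj: "1 / \<alpha> + 1 / q = 1" and p: "1 < p"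
    and S: "0 < S" and x: "0 \<le> x" and u: "0 \<le> u" and \<delta>: "0 < \<delta>"
  shows "ennreal ((x * \<delta>) powr p)
    \<le> ennreal (S powr (1 - \<alpha>) / \<alpha>) *
        (ennreal_pow (ennreal u) \<alpha> * ennreal_pow (ennreal x) \<alpha>)
      + ennreal (S / q) *
        (ennreal_pow (ennreal x) (q * (p - 1)) * ennreal_pow (ennreal u) (- q) *
         ennreal_pow (ennreal \<delta>) (p * q))"
proof -
  consider "x = 0" | "0 < x" "u = 0" | "0 < x" "0 < u" using x u by fastforce
  then show ?thesis
  proof cases
    case 1
    then show ?thesis by simp
  next
    case 2
    have "ennreal_pow (ennreal x) (q * (p - 1)) * ennreal_pow (ennreal u) (- q) *
         ennreal_pow (ennreal \<delta>) (p * q) = top"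
      using 2 q \<delta> by (simp add: ennreal_pow_ennreal_pos ennreal_pow_def ennreal_mult_eq_top_iff)
    moreover have "ennreal (S / q) * top = top"
      using S q by (simp add: ennreal_mult_top)
    ultimately show ?thesis by simp
  next
    case 3
    define t where "t = S powr (- (1 / q))"
    have t: "0 < t" using S by (simp add: t_def)
    have q1: "\<alpha> / q = \<alpha> - 1" using conj \<alpha> q by (simp add: field_simps)
    have tp: "t powr \<alpha> = S powr (1 - \<alpha>)" "t powr (- q) = S"
      using q q1 S by (simp_all add: t_def powr_powr)
    define A where "A = u * x"
    define B where "B = x powr (p - 1) * u powr (- 1) * \<delta> powr p"
    have AB: "0 < A" "0 < B" using 3 \<delta> by (auto simp: A_def B_def)
    have "x powr p = x * x powr (p - 1)"
      using 3 by (simp add: powr_diff)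
    then have "(x * \<delta>) powr p = (t * A) * (B / t)"
      using 3 t by (simp add: A_def B_def powr_mult powr_minus)
    also have "\<dots> \<le> (t * A) powr \<alpha> / \<alpha> + (B / t) powr q / q"
      using t AB by (intro Youngs_inequality \<alpha> q conj) auto
    also have "(t * A) powr \<alpha> = S powr (1 - \<alpha>) * (u powr \<alpha> * x powr \<alpha>)"
      by (simp add: powr_mult A_def tp)
    also have "B / t = B * t powr (- 1)" using t by (simp add: powr_minus divide_inverse)
    also have "(B * t powr (- 1)) powr q = B powr q * S"
      using tp(2) by (simp only: powr_mult powr_powr) simp
    also have "B powr q = x powr (q * (p - 1)) * u powr (- q) * \<delta> powr (p * q)"
      unfolding B_def by (simp only: powr_mult powr_powr) (simp add: mult.commute)
    finally have "(x * \<delta>) powr p \<le> S powr (1 - \<alpha>) / \<alpha> * (u powr \<alpha> * x powr \<alpha>)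
        + S / q * (x powr (q * (p - 1)) * u powr (- q) * \<delta> powr (p * q))"
      by (simp add: mult_ac)
    then have "ennreal ((x * \<delta>) powr p) \<le> ennreal (S powr (1 - \<alpha>) / \<alpha> * (u powr \<alpha> * x powr \<alpha>)
        + S / q * (x powr (q * (p - 1)) * u powr (- q) * \<delta> powr (p * q)))"
      by (rule ennreal_leI)
    then show ?thesis
      using 3 \<delta> S \<alpha> q by (simp add: ennreal_pow_ennreal_pos flip: ennreal_mult ennreal_plus)
  qed
qed

lemma measurable_mu_ennreal_pow:
  assumes "f \<in> borel_measurable (mu a)"
  shows "(\<lambda>x. ennreal_pow (ennreal (f x)) s) \<in> borel_measurable (mu a)"
  by (rule measurable_compose[OF measurable_compose[OF assms measurable_ennreal] measurable_ennreal_pow])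

lemma mu_integral_le_functional_bound:
  fixes \<alpha> q p S :: real
  assumes \<alpha>: "1 < \<alpha>" and q: "1 < q" and conj: "1 / \<alpha> + 1 / q = 1" and p: "1 < p"
    and S: "0 < S" and a: "cmod a < 1"
    and g: "deriv F holomorphic_on unit_disc"
    and \<omega>: "\<omega> \<in> S3 p q F" and le: "S3_functional \<alpha> F \<omega> \<le> ennreal S"
  shows "(\<integral>\<^sup>+x. ennreal ((cmod (deriv F (fst x)) * (1 - cmod (fst x))) powr p) \<partial>mu a) \<le> ennreal S"
proof -
  define I where "I x = ennreal_pow (ennreal (\<omega> x)) \<alpha> *
      ennreal_pow (ennreal (cmod (deriv F (fst x)))) \<alpha>" for x
  define J where "J x = ennreal_pow (ennreal (cmod (deriv F (fst x)))) (q * (p - 1)) *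
      ennreal_pow (ennreal (\<omega> x)) (- q) * ennreal_pow (ennreal (1 - cmod (fst x))) (p * q)" for x
  have \<omega>m: "\<omega> \<in> borel_measurable (mu a)" and \<omega>0: "\<And>x. x \<in> unit_disc \<times> unit_disc \<Longrightarrow> 0 \<le> \<omega> x"
    and sup: "(SUP a\<in>unit_disc. \<integral>\<^sup>+x. J x \<partial>mu a) \<le> 1"
    using \<omega> by (auto simp: S3_def J_def case_prod_unfold measurable_cong_sets[OF sets_mu refl])
  have gm: "(\<lambda>x. cmod (deriv F (fst x))) \<in> borel_measurable (mu a)"
    by (intro measurable_mu_continuous continuous_intros holomorphic_on_imp_continuous_on g)
  have dm: "(\<lambda>x. 1 - cmod (fst x)) \<in> borel_measurable (mu a)"
    by (intro measurable_mu_continuous continuous_intros)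
  have [measurable]: "I \<in> borel_measurable (mu a)" "J \<in> borel_measurable (mu a)"
    unfolding I_def J_def
    by (intro borel_measurable_times_ennreal measurable_mu_ennreal_pow \<omega>m gm dm)+
  have J1: "(\<integral>\<^sup>+x. J x \<partial>mu a) \<le> 1"
    using order_trans[OF SUP_upper sup, of a] a by simp
  have "ennreal_pow (\<integral>\<^sup>+x. I x \<partial>mu a) (1 / \<alpha>) \<le> S3_functional \<alpha> F \<omega>"
    unfolding S3_functional_def I_def case_prod_unfold using a by (intro SUP_upper2[of a]) auto
  with le have "ennreal_pow (\<integral>\<^sup>+x. I x \<partial>mu a) (1 / \<alpha>) \<le> ennreal S" by order
  then have I1: "(\<integral>\<^sup>+x. I x \<partial>mu a) \<le> ennreal (S powr \<alpha>)"
    using le_powr_of_ennreal_pow_le[of "1 / \<alpha>" S] \<alpha> S by simp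
  have "(\<integral>\<^sup>+x. ennreal ((cmod (deriv F (fst x)) * (1 - cmod (fst x))) powr p) \<partial>mu a)
      \<le> (\<integral>\<^sup>+x. ennreal (S powr (1 - \<alpha>) / \<alpha>) * I x + ennreal (S / q) * J x \<partial>mu a)"
    unfolding I_def J_def
    by (intro nn_integral_mono scaled_Young \<alpha> q conj p S \<omega>0) auto
  also have "\<dots> = ennreal (S powr (1 - \<alpha>) / \<alpha>) * (\<integral>\<^sup>+x. I x \<partial>mu a) + ennreal (S / q) * (\<integral>\<^sup>+x. J x \<partial>mu a)"
    by (simp add: nn_integral_add nn_integral_cmult)
  also have "\<dots> \<le> ennreal (S powr (1 - \<alpha>) / \<alpha>) * ennreal (S powr \<alpha>) + ennreal (S / q) * 1"
    by (intro add_mono mult_left_mono I1 J1) auto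
  also have "\<dots> = ennreal (S powr (1 - \<alpha>) / \<alpha> * S powr \<alpha> + S / q)"
    using S \<alpha> q by (simp add: ennreal_plus flip: ennreal_mult)
  also have "S powr (1 - \<alpha>) / \<alpha> * S powr \<alpha> = S / \<alpha>"
    using S by (simp flip: powr_add)
  also have "S / \<alpha> + S / q = S * (1 / \<alpha> + 1 / q)" by (simp add: algebra_simps)
  finally show ?thesis by (simp add: conj)
qed

text \<open>The bound of \<open>mu_integral_le_functional_bound\<close> needs a positive finite \<open>S\<close>, so the functional is enlarged by
  an arbitrary \<open>e > 0\<close>; this covers the case in which it vanishes. The finiteness of the seminorm is a
  consequence of the pointwise estimates.\<close>

lemma bloch_seminorm_le_functional:
  fixes \<alpha> q p :: real
  assumes \<alpha>: "1 < \<alpha>" and q: "1 < q" and conj: "1 / \<alpha> + 1 / q = 1" and p: "2 \<le> p"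
    and g: "deriv F holomorphic_on unit_disc" and \<omega>: "\<omega> \<in> S3 p q F"
  shows "ennreal (pi\<^sup>2 / 104976 / 128 powr p) * ennreal_pow (bloch_seminorm F) p
    \<le> S3_functional \<alpha> F \<omega>"
proof (rule ennreal_le_epsilon)
  fix e :: real
  assume fin: "S3_functional \<alpha> F \<omega> < top" and e: "0 < e"
  define c where "c = pi\<^sup>2 / 104976 / 128 powr p"
  have c: "0 < c" by (simp add: c_def)
  define S where "S = enn2real (S3_functional \<alpha> F \<omega>) + e"
  have S: "0 < S" using e by (simp add: S_def add_nonneg_pos)
  have Seq: "S3_functional \<alpha> F \<omega> + ennreal e = ennreal S"
    using fin e by (simp add: S_def ennreal_plus less_top)
  have le: "S3_functional \<alpha> F \<omega> \<le> ennreal S" unfolding Seq[symmetric] by simp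
  have pt: "ennreal (cmod (deriv F z) * (1 - cmod z)) \<le> ennreal ((S / c) powr (1 / p))"
    if z: "cmod z < 1" for z
  proof -
    obtain a where a: "cmod a < 1" and ca: "ennreal (c * (cmod (deriv F z) * (1 - cmod z)) powr p)
       \<le> (\<integral>\<^sup>+x. ennreal ((cmod (deriv F (fst x)) * (1 - cmod (fst x))) powr p) \<partial>mu a)"
      using bloch_term_le_mu_integral[OF g p z] unfolding c_def by blast
    note ca
    also have "(\<integral>\<^sup>+x. ennreal ((cmod (deriv F (fst x)) * (1 - cmod (fst x))) powr p) \<partial>mu a) \<le> ennreal S"
      using p by (intro mu_integral_le_functional_bound[OF \<alpha> q conj _ S a g \<omega> le]) auto
    finally have "(cmod (deriv F z) * (1 - cmod z)) powr p \<le> S / c"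
      using S c by (simp add: field_simps)
    then have "((cmod (deriv F z) * (1 - cmod z)) powr p) powr (1 / p) \<le> (S / c) powr (1 / p)"
      using p by (intro powr_mono2) auto
    then show ?thesis
      using p z by (intro ennreal_leI) (simp add: powr_powr)
  qed
  have "bloch_seminorm F \<le> ennreal ((S / c) powr (1 / p))"
    unfolding bloch_seminorm_def by (intro SUP_least pt) auto
  then have "ennreal_pow (bloch_seminorm F) p \<le> ennreal_pow (ennreal ((S / c) powr (1 / p))) p"
    using p by (intro ennreal_pow_mono) auto
  also have "\<dots> = ennreal (S / c)"
    using p S c by (simp add: ennreal_pow_ennreal powr_powr)
  finally have "ennreal c * ennreal_pow (bloch_seminorm F) p \<le> ennreal c * ennreal (S / c)"
    by (intro mult_left_mono) auto
  also have "\<dots> = ennreal S" using c S by (simp flip: ennreal_mult)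
  finally show "ennreal (pi\<^sup>2 / 104976 / 128 powr p) * ennreal_pow (bloch_seminorm F) p
      \<le> S3_functional \<alpha> F \<omega> + ennreal e"
    by (simp add: Seq c_def)
qed

section \<open>A weight that is optimal up to constants\<close>

text \<open>Making the integrand of the constraint constant off the zeros of \<open>F'\<close> forces
  \<open>\<omega> = k |F'|\<^bsup>p-1\<^esup> (1 - |z|)\<^bsup>p\<^esup>\<close>, and then \<open>\<omega> |F'| = k (|F'| (1 - |z|))\<^bsup>p\<^esup>\<close> is bounded in terms of
  the seminorm. The constraint integrand is at most \<open>k\<^bsup>-q\<^esup>\<close>, so \<open>k = K\<^bsup>1/q\<^esup>\<close> makes \<open>\<omega>\<close> admissible. At zeros of \<open>F'\<close> the
  convention \<open>0 \<cdot> \<infinity> = 0\<close> applies, since \<open>q (p - 1) > 0\<close>.\<close>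

lemma admissible_weight_with_small_functional:
  fixes \<alpha> q p K :: real
  assumes \<alpha>: "1 < \<alpha>" and q: "1 < q" and p: "1 < p" and K: "1 \<le> K"
    and mass: "\<And>a. cmod a < 1 \<Longrightarrow> emeasure (mu a) (unit_disc \<times> unit_disc) \<le> ennreal K"
    and g: "deriv F holomorphic_on unit_disc" and fin: "bloch_seminorm F \<noteq> \<infinity>"
  shows "\<exists>\<omega>\<in>S3 p q F. S3_functional \<alpha> F \<omega>
    \<le> ennreal (K powr (1 / q + 1 / \<alpha>)) * ennreal_pow (bloch_seminorm F) p"
proof -
  define N where "N = enn2real (bloch_seminorm F)"
  have N: "bloch_seminorm F = ennreal N" "0 \<le> N" using fin by (auto simp: N_def less_top)
  have ptN: "cmod (deriv F z) * (1 - cmod z) \<le> N" if "cmod z < 1" for z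
  proof -
    have "ennreal (cmod (deriv F z) * (1 - cmod z)) \<le> ennreal N"
      unfolding N(1)[symmetric] bloch_seminorm_def using that by (intro SUP_upper) auto
    then show ?thesis using N by simp
  qed
  define k where "k = K powr (1 / q)"
  have k: "0 < k" using K by (simp add: k_def)
  define \<omega> :: "complex \<times> complex \<Rightarrow> real" where
    "\<omega> x = k * (cmod (deriv F (fst x)) powr (p - 1) * (1 - cmod (fst x)) powr p)" for x
  have \<omega>m: "\<omega> \<in> borel_measurable (mu a)" for a
    unfolding \<omega>_def using p
    by (intro measurable_mu_continuous continuous_intros holomorphic_on_imp_continuous_on g
        continuous_on_powr') auto
  have S3: "\<omega> \<in> S3 p q F"
    unfolding S3_def
  proof (safe intro!: SUP_least)
    show "\<omega> \<in> borel_measurable (lebesgue_on (unit_disc \<times> unit_disc))"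
      using \<omega>m[of 0] by (simp add: measurable_cong_sets[OF sets_mu refl])
    show "0 \<le> \<omega> (z, w)" for z w using k by (simp add: \<omega>_def)
    fix a :: complex
    assume a: "a \<in> unit_disc"
    have "(\<integral>\<^sup>+(z, w). ennreal_pow (ennreal (cmod (deriv F z))) (q * (p - 1)) *
             ennreal_pow (ennreal (\<omega> (z, w))) (- q) *
             ennreal_pow (ennreal (1 - cmod z)) (p * q) \<partial>mu a)
        \<le> (\<integral>\<^sup>+x. ennreal (1 / K) \<partial>mu a)"
    proof (intro nn_integral_mono)
      fix x assume "x \<in> space (mu a)"
      then obtain z w where x: "x = (z, w)" and z: "cmod z < 1" by (cases x) auto
      define y where "y = cmod (deriv F z)"
      have "0 \<le> y" by (simp add: y_def)
      then consider "y = 0" | "0 < y" by fastforce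
      then have "ennreal_pow (ennreal y) (q * (p - 1)) *
           ennreal_pow (ennreal (k * (y powr (p - 1) * (1 - cmod z) powr p))) (- q) *
           ennreal_pow (ennreal (1 - cmod z)) (p * q) \<le> ennreal (1 / K)"
      proof cases
        case 1
        then have "ennreal_pow (ennreal y) (q * (p - 1)) = 0"
          using p q by (subst ennreal_pow_ennreal) auto
        then show ?thesis by simp
      next
        case 2
        have kq: "k powr (- q) = 1 / K"
          using K q by (simp add: k_def powr_powr powr_minus divide_inverse)
        have "y powr (q * (p - 1)) * (k * (y powr (p - 1) * (1 - cmod z) powr p)) powr (- q)
             * (1 - cmod z) powr (p * q)
           = k powr (- q) * (y powr (q * (p - 1)) * y powr (- (q * (p - 1))))
             * ((1 - cmod z) powr (p * q) * (1 - cmod z) powr (- (p * q)))"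
          by (simp add: powr_mult powr_powr mult_ac)
        also have "\<dots> = 1 / K"
          using 2 z by (simp add: kq flip: powr_add)
        finally show ?thesis
          using 2 z k by (simp add: ennreal_pow_ennreal_pos flip: ennreal_mult)
      qed
      then show "(case x of (z, w) \<Rightarrow> ennreal_pow (ennreal (cmod (deriv F z))) (q * (p - 1)) *
             ennreal_pow (ennreal (\<omega> (z, w))) (- q) *
             ennreal_pow (ennreal (1 - cmod z)) (p * q)) \<le> ennreal (1 / K)"
        by (simp add: x y_def \<omega>_def)
    qed
    also have "\<dots> = ennreal (1 / K) * emeasure (mu a) (unit_disc \<times> unit_disc)" by simp
    also have "\<dots> \<le> ennreal (1 / K) * ennreal K"
      using a by (intro mult_left_mono mass) auto
    also have "\<dots> = 1" using K by (simp flip: ennreal_mult)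
    finally show "(\<integral>\<^sup>+(z, w). ennreal_pow (ennreal (cmod (deriv F z))) (q * (p - 1)) *
             ennreal_pow (ennreal (\<omega> (z, w))) (- q) *
             ennreal_pow (ennreal (1 - cmod z)) (p * q) \<partial>mu a) \<le> 1" .
  qed
  have "S3_functional \<alpha> F \<omega> \<le> ennreal (K powr (1 / q + 1 / \<alpha>) * N powr p)"
    unfolding S3_functional_def
  proof (rule SUP_least)
    fix a :: complex
    assume a: "a \<in> unit_disc"
    have "(\<integral>\<^sup>+(z, w). ennreal_pow (ennreal (\<omega> (z, w))) \<alpha> *
            ennreal_pow (ennreal (cmod (deriv F z))) \<alpha> \<partial>mu a)
        \<le> (\<integral>\<^sup>+x. ennreal ((k * N powr p) powr \<alpha>) \<partial>mu a)"
    proof (intro nn_integral_mono)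
      fix x assume "x \<in> space (mu a)"
      then obtain z w where x: "x = (z, w)" and z: "cmod z < 1" by (cases x) auto
      define y where "y = cmod (deriv F z)"
      have y: "0 \<le> y" by (simp add: y_def)
      have "\<omega> (z, w) * y = k * (y * (1 - cmod z)) powr p"
        using y p by (cases "y = 0") (simp_all add: \<omega>_def y_def[symmetric] powr_diff powr_mult)
      also have "\<dots> \<le> k * N powr p"
        using k z p ptN[OF z] by (intro mult_left_mono powr_mono2) (auto simp: y_def)
      finally have "(\<omega> (z, w) * y) powr \<alpha> \<le> (k * N powr p) powr \<alpha>"
        using \<alpha> k y by (intro powr_mono2) (auto simp: \<omega>_def)
      then have "ennreal (\<omega> (z, w) powr \<alpha>) * ennreal (y powr \<alpha>) \<le> ennreal ((k * N powr p) powr \<alpha>)"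
        by (simp add: powr_mult ennreal_leI flip: ennreal_mult)
      then show "(case x of (z, w) \<Rightarrow> ennreal_pow (ennreal (\<omega> (z, w))) \<alpha> *
            ennreal_pow (ennreal (cmod (deriv F z))) \<alpha>) \<le> ennreal ((k * N powr p) powr \<alpha>)"
        using \<alpha> k by (simp add: x y_def ennreal_pow_ennreal \<omega>_def)
    qed
    also have "\<dots> = ennreal ((k * N powr p) powr \<alpha>) * emeasure (mu a) (unit_disc \<times> unit_disc)" by simp
    also have "\<dots> \<le> ennreal ((k * N powr p) powr \<alpha>) * ennreal K"
      using a by (intro mult_left_mono mass) auto
    also have "\<dots> = ennreal ((k * N powr p) powr \<alpha> * K)" using K by (simp flip: ennreal_mult)
    finally have "ennreal_pow (\<integral>\<^sup>+(z, w). ennreal_pow (ennreal (\<omega> (z, w))) \<alpha> *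
            ennreal_pow (ennreal (cmod (deriv F z))) \<alpha> \<partial>mu a) (1 / \<alpha>)
        \<le> ennreal_pow (ennreal ((k * N powr p) powr \<alpha> * K)) (1 / \<alpha>)"
      using \<alpha> by (intro ennreal_pow_mono) auto
    also have "\<dots> = ennreal (((k * N powr p) powr \<alpha> * K) powr (1 / \<alpha>))"
      using \<alpha> K by (intro ennreal_pow_ennreal) auto
    also have "((k * N powr p) powr \<alpha> * K) powr (1 / \<alpha>) = K powr (1 / q + 1 / \<alpha>) * N powr p"
      using \<alpha> k by (simp add: powr_mult powr_powr powr_add k_def)
    finally show "ennreal_pow (\<integral>\<^sup>+(z, w). ennreal_pow (ennreal (\<omega> (z, w))) \<alpha> *
            ennreal_pow (ennreal (cmod (deriv F z))) \<alpha> \<partial>mu a) (1 / \<alpha>)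
        \<le> ennreal (K powr (1 / q + 1 / \<alpha>) * N powr p)" .
  qed
  also have "\<dots> = ennreal (K powr (1 / q + 1 / \<alpha>)) * ennreal_pow (bloch_seminorm F) p"
    using N p by (simp add: ennreal_pow_ennreal ennreal_mult)
  finally show ?thesis using S3 by blast
qed

section \<open>The equivalence\<close>

theorem theorem4:
  fixes \<alpha> \<alpha>' p :: real
  assumes "1 < \<alpha>" and "\<alpha> < 2" and "1 / \<alpha> + 1 / \<alpha>' = 1" and "\<alpha>' \<le> p"
  shows "\<exists>c C :: real. 0 < c \<and> c \<le> C \<and>
    (\<forall>F :: complex \<Rightarrow> complex. F analytic_on unit_disc \<and> F 0 = 0 \<longrightarrow>
       ennreal c * ennreal_pow (bloch_seminorm F) p
         \<le> (INF \<omega>\<in>S3 p \<alpha>' F. S3_functional \<alpha> F \<omega>) \<and>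
       (INF \<omega>\<in>S3 p \<alpha>' F. S3_functional \<alpha> F \<omega>)
         \<le> ennreal C * ennreal_pow (bloch_seminorm F) p)"
proof -
  have "1 / \<alpha>' = 1 - 1 / \<alpha>" using assms(3) by simp
  moreover have "0 < 1 - 1 / \<alpha>" "1 - 1 / \<alpha> < 1 / 2" using assms(1,2) by (auto simp: field_simps)
  ultimately have i: "0 < 1 / \<alpha>'" "1 / \<alpha>' < 1 / 2" by auto
  then have "0 < \<alpha>'" by simp
  then have q: "2 < \<alpha>'" using i by (simp add: field_simps)
  then have p: "2 \<le> p" using assms(4) by simp
  define c where "c = pi\<^sup>2 / 104976 / 128 powr p"
  define K where "K = (64 * pi / 3)\<^sup>2"
  have K: "1 \<le> K" using pi_gt3 unfolding K_def by (intro one_le_power) auto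
  have c: "0 < c" "c \<le> 1"
  proof -
    show "0 < c" by (simp add: c_def)
    have "pi\<^sup>2 \<le> 4\<^sup>2" using pi_less_4 by (intro power_mono) auto
    then have "pi\<^sup>2 \<le> 104976 * 1" by simp
    also have "\<dots> \<le> 104976 * 128 powr p"
      using p by (intro mult_left_mono ge_one_powr_ge_zero) auto
    finally show "c \<le> 1" by (simp add: c_def field_simps)
  qed
  show ?thesis
  proof (rule exI[of _ c], rule exI[of _ K], intro conjI allI impI)
    show "0 < c" "c \<le> K" using c K by auto
    fix F :: "complex \<Rightarrow> complex"
    assume "F analytic_on unit_disc \<and> F 0 = 0"
    then have F: "F analytic_on unit_disc" ..
    have g: "deriv F holomorphic_on unit_disc"
      using F by (intro holomorphic_deriv analytic_imp_holomorphic) auto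
    show "ennreal c * ennreal_pow (bloch_seminorm F) p \<le> (INF \<omega>\<in>S3 p \<alpha>' F. S3_functional \<alpha> F \<omega>)"
      unfolding c_def using q
      by (intro INF_greatest bloch_seminorm_le_functional[OF assms(1) _ assms(3) p g]) auto
    show "(INF \<omega>\<in>S3 p \<alpha>' F. S3_functional \<alpha> F \<omega>) \<le> ennreal K * ennreal_pow (bloch_seminorm F) p"
    proof (cases "bloch_seminorm F = \<infinity>")
      case True
      then show ?thesis using p K by (simp add: ennreal_pow_def ennreal_mult_top)
    next
      case False
      have "\<exists>\<omega>\<in>S3 p \<alpha>' F. S3_functional \<alpha> F \<omega>
          \<le> ennreal (K powr (1 / \<alpha>' + 1 / \<alpha>)) * ennreal_pow (bloch_seminorm F) p"
        using q p emeasure_mu_le unfolding K_def[symmetric]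
        by (intro admissible_weight_with_small_functional[OF assms(1) _ _ K _ g False]) auto
      moreover have "K powr (1 / \<alpha>' + 1 / \<alpha>) = K"
        using assms(3) K by (simp add: add.commute)
      ultimately obtain \<omega> where "\<omega> \<in> S3 p \<alpha>' F"
        and "S3_functional \<alpha> F \<omega> \<le> ennreal K * ennreal_pow (bloch_seminorm F) p"
        by metis
      then show ?thesis using INF_lower order_trans by meson
    qed
  qed
qed

end
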